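(* Let $Z=\{z_1,z_2,\ldots\}$, equipped with a total order, let $\mathcal{Z}$ be the $\mathbb{Q}$-algebra of multiple zeta values, and let $I:\mathbb{Q}\langle Z\rangle\to\mathcal{Z}$ be the (surjective) linear map sending a word to its corresponding (normalised) iterated integral. Denote by $L(Z)\subset\mathbb{Q}\langle Z\rangle$ the $\mathbb{Q}$-span of the set of Lyndon words in $Z$. Assume that $I(u\,\hat{\sqcup\!\sqcup}\,v)=0$ for all non-empty words $u,v$ in $Z$, where $\hat{\sqcup\!\sqcup}$ is the block shuffle product. Then $\mathcal{Z}=I(L(Z))$.
   Context: Multiple zeta values: $\zeta(n_1,\ldots,n_r)=\sum_{1\le k_1<\cdots<k_r}k_1^{-n_1}\cdots k_r^{-n_r}$ for positive integers $n_i$ with $n_r\ge 2$; $\mathcal{Z}$ is the $\mathbb{Q}$-span of all of these together with $1$ (a $\mathbb{Q}$-algebra). Block encoding: a word in $\{e_0,e_1\}$ is alternating if it is non-empty and contains no factor $e_0e_0$ or $e_1e_1$. Every non-empty word $w$ has a unique minimal factorisation $w=w_1\cdots w_k$ into alternating words; it is the one in which the last letter of $w_i$ equals the first letter of $w_{i+1}$ for $1\le i<k$. Mapping a word $w$ beginning with $e_0$ to $z_{|w_1|}\cdots z_{|w_k|}$ ($|\cdot|$ denoting length) identifies the words beginning with $e_0$ with the non-empty words in $Z$. The map $I$: if the word $e_{a_0}e_{a_1}\cdots e_{a_{n+1}}$ (with $a_0=0$) corresponds to a word in $Z$, and if $a_{n+1}=1$ and either $n=0$ or ($a_1=1$ and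 $a_n=0$), then $I$ of that word is $$I(0;a_1,\ldots,a_n;1)=\int_{0\le t_1\le\cdots\le t_n\le 1}\prod_{k=1}^n\frac{dt_k}{t_k-a_k},$$ which is $1$ for $n=0$. One has $\zeta(n_1,\ldots,n_r)=(-1)^r I(0;1,\{0\}^{n_1-1},1,\{0\}^{n_2-1},\ldots,1,\{0\}^{n_r-1};1)$. If $a_{n+1}=0$, equivalently if $i_1+\cdots+i_k\equiv k \pmod 2$ for the word $z_{i_1}\cdots z_{i_k}$, then $I(z_{i_1}\cdots z_{i_k})=0$; also $I(1)=0$ for the empty word. On the remaining (divergent) words, $I$ takes values in $\mathcal{Z}$ given by some fixed choice of normalisation (regularisation). Block shuffle product: the bilinear product on $\mathbb{Q}\langle Z\rangle$ defined recursively by $w\,\hat{\sqcup\!\sqcup}\,1=1\,\hat{\sqcup\!\sqcup}\,w=w$ and $z_au\,\hat{\sqcup\!\sqcup}\,z_bv=z_a(u\,\hat{\sqcup\!\sqcup}\,z_bv)+z_b(z_au\,\hat{\sqcup\!\sqcup}\,v)-\zeta_{a+b}(u\,\hat{\sqcup\!\sqcup}\,v)$ for words $u,v,w$, where $\zeta_c$ is the linear map with $\zeta_c(1)=0$ and $\zeta_c(z_bw)=z_{b+c}w$. It is commutative and associative. A Lyndon word is a non-empty word strictly smaller, in the lexicographic order induced by the order on $Z$, than each of its proper non-empty suffixes. *)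

theory Defs
  imports
    "HOL-Analysis.Analysis"
    "HOL-Library.Poly_Mapping"
    "HOL-Library.Sublist"
begin

section \<open>Multiple zeta values\<close>

definition mzv_admissible :: "nat list \<Rightarrow> bool" where
  "mzv_admissible ns \<longleftrightarrow> ns \<noteq> [] \<and> (\<forall>n\<in>set ns. 1 \<le> n) \<and> 2 \<le> last ns"

definition mzv :: "nat list \<Rightarrow> real" where
  "mzv ns = (\<Sum>\<^sub>\<infinity>ks | length ks = length ns \<and> (\<forall>k\<in>set ks. 1 \<le> k) \<and> sorted_wrt (<) ks.
     \<Prod>i<length ns. 1 / real (ks ! i) ^ (ns ! i))"

abbreviation rat_scale :: "rat \<Rightarrow> real \<Rightarrow> real" where
  "rat_scale q x \<equiv> of_rat q * x"

definition mzv_space :: "real set" where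
  "mzv_space = module.span rat_scale (insert 1 (mzv ` {ns. mzv_admissible ns}))"


section \<open>Noncommutative polynomials in \<open>z\<^sub>1, z\<^sub>2, \<dots>\<close>\<close>

typedef letter = "{i::nat. 1 \<le> i}"
  morphisms idx z
  by auto

text \<open>The finitely supported functions on words with rational values form the underlying
  vector space of the free algebra; its concatenation product is not used.\<close>

type_synonym ncpoly = "letter list \<Rightarrow>\<^sub>0 rat"

definition word :: "letter list \<Rightarrow> ncpoly" where
  "word w = Poly_Mapping.single w 1"

definition nc_scale :: "rat \<Rightarrow> ncpoly \<Rightarrow> ncpoly" where
  "nc_scale q p = Poly_Mapping.map (\<lambda>c. q * c) p"

definition nc_extend :: "(letter list \<Rightarrow> ncpoly) \<Rightarrow> ncpoly \<Rightarrow> ncpoly" where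
  "nc_extend f p = (\<Sum>w\<in>Poly_Mapping.keys p. nc_scale (Poly_Mapping.lookup p w) (f w))"

lemma vector_space_rat_scale: "vector_space rat_scale"
  by unfold_locales (simp_all add: algebra_simps of_rat_add of_rat_mult)

lemma lookup_nc_scale: "Poly_Mapping.lookup (nc_scale q p) w = q * Poly_Mapping.lookup p w"
  by (simp add: nc_scale_def Poly_Mapping.map.rep_eq when_def)

lemma vector_space_nc_scale: "vector_space nc_scale"
  by unfold_locales
    (simp_all add: poly_mapping_eq_iff fun_eq_iff lookup_nc_scale lookup_add algebra_simps)


section \<open>The block shuffle product\<close>

definition prepend :: "letter \<Rightarrow> ncpoly \<Rightarrow> ncpoly" where
  "prepend a = nc_extend (\<lambda>w. word (a # w))"

definition zeta_op :: "nat \<Rightarrow> ncpoly \<Rightarrow> ncpoly" where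
  "zeta_op c = nc_extend (\<lambda>w. case w of [] \<Rightarrow> 0 | b # w' \<Rightarrow> word (z (idx b + c) # w'))"

fun block_shuffle_words :: "letter list \<Rightarrow> letter list \<Rightarrow> ncpoly" where
  "block_shuffle_words [] w = word w"
| "block_shuffle_words w [] = word w"
| "block_shuffle_words (a # u) (b # v) =
     prepend a (block_shuffle_words u (b # v)) + prepend b (block_shuffle_words (a # u) v)
     - zeta_op (idx a + idx b) (block_shuffle_words u v)"

definition block_shuffle :: "ncpoly \<Rightarrow> ncpoly \<Rightarrow> ncpoly" where
  "block_shuffle p q = nc_extend (\<lambda>u. nc_extend (\<lambda>v. block_shuffle_words u v) q) p"


section \<open>Block encoding and iterated integrals\<close>

text \<open>Words in \<open>e\<^sub>0, e\<^sub>1\<close> are lists of Booleans, with \<open>False\<close> for \<open>e\<^sub>0\<close> and \<open>True\<close> for \<open>e\<^sub>1\<close>.\<close>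

definition alternating :: "bool list \<Rightarrow> bool" where
  "alternating w \<longleftrightarrow> w \<noteq> [] \<and> \<not> (\<exists>a. sublist [a, a] w)"

definition block_factorisation :: "bool list \<Rightarrow> bool list list" where
  "block_factorisation w = (ARG_MIN length ws. concat ws = w \<and> (\<forall>v\<in>set ws. alternating v))"

definition block_encode :: "bool list \<Rightarrow> letter list" where
  "block_encode w = map (\<lambda>v. z (length v)) (block_factorisation w)"

text \<open>For a list \<open>as\<close> with entries \<open>a\<^sub>1, \<dots>, a\<^sub>n\<close>, this is \<open>I(0; a\<^sub>1, \<dots>, a\<^sub>n; 1)\<close>. The coordinates are
  numbered from \<open>0\<close> to \<open>n - 1\<close>. The zeros of the denominators form a null set, so their
  value there is irrelevant.\<close>

definition iterated_integral :: "bool list \<Rightarrow> real" where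
  "iterated_integral as =
     set_lebesgue_integral (\<Pi>\<^sub>M k\<in>{..<length as}. lborel)
       {t. (\<forall>k<length as. 0 \<le> t k \<and> t k \<le> 1) \<and> mono_on {..<length as} t}
       (\<lambda>t. \<Prod>k<length as. 1 / (t k - of_bool (as ! k)))"

definition convergent_word :: "bool list \<Rightarrow> bool" where
  "convergent_word as \<longleftrightarrow> as = [] \<or> (hd as \<and> \<not> last as)"

text \<open>The linear maps that agree with the iterated integrals on all words for which these are
  prescribed, and take arbitrary values in the space of multiple zeta values on the words
  \<open>e\<^sub>0 e\<^bsub>a\<^sub>1\<^esub> \<dots> e\<^bsub>a\<^sub>n\<^esub> e\<^sub>1\<close> with divergent integral; each choice of these values is a normalisation.\<close>

definition normalised_integral_map :: "(ncpoly \<Rightarrow> real) \<Rightarrow> bool" where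
  "normalised_integral_map I \<longleftrightarrow>
     Vector_Spaces.linear nc_scale rat_scale I \<and>
     I (word []) = 0 \<and>
     (\<forall>w. w \<noteq> [] \<and> \<not> hd w \<and> \<not> last w \<longrightarrow> I (word (block_encode w)) = 0) \<and>
     (\<forall>as. convergent_word as \<longrightarrow>
        I (word (block_encode ([False] @ as @ [True]))) = iterated_integral as) \<and>
     (\<forall>as. \<not> convergent_word as \<longrightarrow>
        I (word (block_encode ([False] @ as @ [True]))) \<in> mzv_space)"


section \<open>Lyndon words\<close>

definition lyndon :: "letter rel \<Rightarrow> letter list \<Rightarrow> bool" where
  "lyndon r w \<longleftrightarrow> w \<noteq> [] \<and> (\<forall>v. v \<noteq> [] \<and> strict_suffix v w \<longrightarrow> (w, v) \<in> lexord (r - Id))"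

definition lyndon_span :: "letter rel \<Rightarrow> ncpoly set" where
  "lyndon_span r = module.span nc_scale (word ` {w. lyndon r w})"

end

theory Submission
  imports Defs
begin

text \<open>
Two facts combine. A convergent iterated integral is either the empty one, with value \<open>1\<close>, or its
letters form blocks of one letter \<open>1\<close> followed by letters \<open>0\<close>, and up to sign it is the multiple
zeta value whose arguments are the block lengths; so the values of \<open>I\<close> on words span the space of
multiple zeta values. And modulo block shuffle products
every word is a combination of Lyndon words and the empty word, so Lyndon words alone suffice.

For the first fact, the integral over the simplex below \<open>x\<close> is expanded as a power series in \<open>x\<close>.
Appending a letter to the word integrates the series against \<open>dt / t\<close> or \<open>dt / (1 - t)\<close>, which
transforms the coefficients by a simple recursion that also governs the sums over
\<open>k\<^sub>1 < \<dots> < k\<^sub>r = k\<close> (lemmas \<open>simplex_integral_series\<close> and \<open>mzv_eq_series\<close>). All terms are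
nonnegative once the sign is split off, so the computation is carried out in \<open>[0, \<infinity>]\<close>, where sums
and integrals commute; the passage back to the reals sends \<open>\<infinity>\<close> to \<open>0\<close>, which is also the value given
to divergent integrals and sums. A recursive description of the minimal block
factorisation shows that every non-empty word in the letters \<open>z\<^sub>i\<close> is the code of a word that
begins with \<open>e\<^sub>0\<close>, so that these integrals determine the range of \<open>I\<close>.

For the second fact, the correction term \<open>\<zeta>\<^sub>a\<^sub>+\<^sub>b\<close> shortens words, so the part of a block shuffle
product of maximal length is the ordinary shuffle product. It therefore suffices that a non-Lyndon
word \<open>w\<close> is the largest shuffle of some pair of non-empty words \<open>u, v\<close>: then \<open>I(w)\<close> is a rational
combination of values at shorter words and at smaller words of the same length, and induction
applies. The order on the letters need not be a well-order, but only finitely many words of a given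
length use letters of \<open>w\<close>.

The pair \<open>u, v\<close> is found numerically. Reading words over a finite alphabet as integers in base \<open>B\<close>
turns the lexicographic order on words of equal length into the order of the integers. The periodic
word \<open>x x x \<dots>\<close>, read as a fraction in base \<open>B\<close>, then has the value
\<open>val x / (B ^ length x - 1)\<close>. Among the non-empty suffixes of \<open>w\<close> let \<open>v\<close> minimise this
number, with minimum \<open>c\<close>, and write \<open>w = u @ v\<close>. Subtracting \<open>c * (B - 1)\<close> from every digit makes the
value of each suffix of \<open>u\<close> nonnegative, that of each prefix of \<open>v\<close> nonpositive and that of \<open>v\<close> zero.
Moving letters of \<open>v\<close> ahead of letters of \<open>u\<close> then can only decrease the value, so that \<open>u @ v\<close> is the
largest shuffle (lemma \<open>shuffles_radix_value_le\<close>). If \<open>w\<close> itself is the only minimiser, the same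
inequalities force \<open>w\<close> to be Lyndon (lemma \<open>lyndon_if_slope_less\<close>).
\<close>

section \<open>Nested harmonic sums by recursion\<close>

text \<open>
The effect on power series coefficients of integrating \<open>\<Sum>k. c k * t ^ k\<close> from \<open>0\<close> to \<open>x\<close> against
\<open>dt / (1 - t)\<close> (for \<open>a\<close>) or \<open>dt / t\<close> (otherwise, for \<open>c 0 = 0\<close>). Division by zero makes the constant coefficient \<open>0\<close>,
as it should be for an integral from \<open>0\<close>.
\<close>

definition append_coeff :: "bool \<Rightarrow> (nat \<Rightarrow> real) \<Rightarrow> nat \<Rightarrow> real" where
  "append_coeff a c k = (if a then \<Sum>j<k. c j else c k) / real k"

definition series_coeff :: "bool list \<Rightarrow> nat \<Rightarrow> real" where
  "series_coeff as = fold append_coeff as (\<lambda>k. of_bool (k = 0))"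

lemma series_coeff_Nil: "series_coeff [] k = of_bool (k = 0)"
  by (simp add: series_coeff_def)

lemma series_coeff_append1:
  "series_coeff (as @ [a]) k =
    (if a then \<Sum>j<k. series_coeff as j else series_coeff as k) / real k"
  by (simp add: series_coeff_def append_coeff_def)

lemma series_coeff_nonneg: "0 \<le> series_coeff as k"
  by (induction as arbitrary: k rule: rev_induct)
    (auto simp: series_coeff_Nil series_coeff_append1 intro!: divide_nonneg_nonneg sum_nonneg)

lemma series_coeff_zero: "as \<noteq> [] \<Longrightarrow> series_coeff as 0 = 0"
  by (induction as rule: rev_induct) (auto simp: series_coeff_append1)

lemma series_coeff_replicate_False:
  "series_coeff (as @ replicate m False) k = series_coeff as k / real k ^ m"
proof (induction m)
  case (Suc m)
  have "as @ replicate (Suc m) False = (as @ replicate m False) @ [False]"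
    by (simp add: replicate_append_same)
  then show ?case using Suc by (simp only: series_coeff_append1) simp
qed simp

text \<open>
The word \<open>1, 0, \<dots>, 0, 1, 0, \<dots>, 0, \<dots>\<close> whose iterated integral is \<open>\<zeta>(n\<^sub>1, \<dots>, n\<^sub>r)\<close> up to sign.
\<close>

definition mzv_word :: "nat list \<Rightarrow> bool list" where
  "mzv_word ns = concat (map (\<lambda>n. True # replicate (n - 1) False) ns)"

lemma mzv_word_snoc:
  "mzv_word (ns @ [n]) = mzv_word ns @ True # replicate (n - 1) False"
  by (simp add: mzv_word_def)

text \<open>
The default \<open>0\<close> for the last entry of the empty chain matches the constant series \<open>1\<close> that belongs
to the empty word, and makes the recursion below uniform in \<open>r\<close>.
\<close>

definition chains :: "nat \<Rightarrow> nat \<Rightarrow> nat list set" where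
  "chains r k = {ks. length ks = r \<and> (\<forall>j\<in>set ks. 1 \<le> j) \<and> sorted_wrt (<) ks \<and> last (0 # ks) = k}"

lemma chains_0: "chains 0 k = (if k = 0 then {[]} else {})"
  by (auto simp: chains_def)

lemma chains_Suc: "chains (Suc r) k = (\<lambda>ks. ks @ [k]) ` (\<Union>j<k. chains r j)"
proof (intro equalityI subsetI)
  fix xs assume xs: "xs \<in> chains (Suc r) k"
  then obtain ks l where "xs = ks @ [l]"
    by (cases xs rule: rev_cases) (auto simp: chains_def)
  with xs have *: "xs = ks @ [k]" "length ks = r" "\<forall>j\<in>set ks. 1 \<le> j" "1 \<le> k"
    "sorted_wrt (<) ks" "\<forall>j\<in>set ks. j < k"
    by (auto simp: chains_def sorted_wrt_append)
  have "last (0 # ks) \<in> insert 0 (set ks)"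
    by (metis last_in_set list.distinct(1) list.simps(15))
  then have "last (0 # ks) < k" using *(4,6) by auto
  with * show "xs \<in> (\<lambda>ks. ks @ [k]) ` (\<Union>j<k. chains r j)"
    by (auto simp: chains_def simp del: last.simps)
next
  fix xs assume "xs \<in> (\<lambda>ks. ks @ [k]) ` (\<Union>j<k. chains r j)"
  then obtain ks where xs: "xs = ks @ [k]" and lt: "last (0 # ks) < k"
    and ks: "length ks = r" "\<forall>j\<in>set ks. 1 \<le> j" "sorted_wrt (<) ks"
    by (auto simp: chains_def simp del: last.simps)
  have "\<forall>j\<in>set ks. j \<le> last (0 # ks)"
  proof
    fix j assume j: "j \<in> set ks"
    then obtain ys l where ys: "ks = ys @ [l]" by (cases ks rule: rev_cases) auto
    with ks(3) j show "j \<le> last (0 # ks)" by (auto simp: sorted_wrt_append)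
  qed
  with lt have "\<forall>j\<in>set ks. j < k" by auto
  moreover have "last (0 # xs) = k" using xs by simp
  ultimately show "xs \<in> chains (Suc r) k"
    using xs lt ks by (auto simp: chains_def sorted_wrt_append simp del: last.simps)
qed

lemma finite_chains: "finite (chains r k)"
  by (induction r arbitrary: k) (auto simp: chains_0 chains_Suc)

definition chain_term :: "nat list \<Rightarrow> nat list \<Rightarrow> real" where
  "chain_term ns ks = (\<Prod>i<length ns. 1 / real (ks ! i) ^ (ns ! i))"

lemma chain_term_snoc:
  assumes "length ks = length ns"
  shows "chain_term (ns @ [n]) (ks @ [k]) = chain_term ns ks / real k ^ n"
proof -
  have "(\<Prod>i<length ns. 1 / real ((ks @ [k]) ! i) ^ ((ns @ [n]) ! i)) = chain_term ns ks"
    unfolding chain_term_def using assms by (intro prod.cong) (auto simp: nth_append)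
  then show ?thesis using assms by (simp add: chain_term_def nth_append)
qed

text \<open>
Peeling off the largest index \<open>k\<close> of a chain leaves a chain that ends strictly below \<open>k\<close>. This
is the partial sum contributed by a letter \<open>1\<close>; the factor \<open>1 / k ^ n\<close> comes from this letter and
the \<open>n - 1\<close> letters \<open>0\<close> that follow it.
\<close>

lemma series_coeff_mzv_word:
  assumes "\<forall>n\<in>set ns. 1 \<le> n"
  shows "series_coeff (mzv_word ns) k = (\<Sum>ks\<in>chains (length ns) k. chain_term ns ks)"
  using assms
proof (induction ns arbitrary: k rule: rev_induct)
  case Nil
  then show ?case by (auto simp: mzv_word_def series_coeff_Nil chains_0 chain_term_def)
next
  case (snoc n ns)
  then have IH: "series_coeff (mzv_word ns) j = (\<Sum>ks\<in>chains (length ns) j. chain_term ns ks)" for j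
    by simp
  have n: "n = Suc (n - 1)" using snoc.prems by simp
  have "series_coeff (mzv_word (ns @ [n])) k
      = series_coeff (mzv_word ns @ [True]) k / real k ^ (n - 1)"
    using series_coeff_replicate_False[of "mzv_word ns @ [True]" "n - 1" k]
    by (simp add: mzv_word_snoc)
  also have "\<dots> = (\<Sum>j<k. series_coeff (mzv_word ns) j) / real k ^ n"
    by (subst (2) n) (simp add: series_coeff_append1)
  also have "(\<Sum>j<k. series_coeff (mzv_word ns) j)
      = (\<Sum>ks\<in>(\<Union>j<k. chains (length ns) j). chain_term ns ks)"
    unfolding IH
  proof (rule sum.UNION_disjoint[symmetric])
    show "\<forall>i\<in>{..<k}. \<forall>j\<in>{..<k}. i \<noteq> j \<longrightarrow> chains (length ns) i \<inter> chains (length ns) j = {}"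
      by (auto simp: chains_def)
  qed (simp_all add: finite_chains)
  also have "\<dots> / real k ^ n
      = (\<Sum>ks\<in>(\<Union>j<k. chains (length ns) j). chain_term (ns @ [n]) (ks @ [k]))"
    unfolding sum_divide_distrib
    by (rule sum.cong) (auto simp: chain_term_snoc chains_def)
  also have "\<dots> = (\<Sum>ks\<in>chains (length (ns @ [n])) k. chain_term (ns @ [n]) ks)"
    by (simp add: chains_Suc sum.reindex inj_on_def)
  finally show ?case .
qed

text \<open>
Grouping the chains by their largest element. If the sum diverges, both sides are \<open>0\<close>: the left by
the convention for \<open>infsum\<close>, the right because \<open>enn2real\<close> sends \<open>\<infinity>\<close> to \<open>0\<close>.
\<close>

lemma mzv_eq_series:
  assumes "\<forall>n\<in>set ns. 1 \<le> n"
  shows "mzv ns = enn2real (suminf (\<lambda>k. ennreal (series_coeff (mzv_word ns) k)))"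
proof -
  let ?c = "series_coeff (mzv_word ns)"
  let ?C = "chains (length ns)"
  let ?S = "Sigma UNIV ?C"
  have pos: "0 \<le> chain_term ns ks" for ks by (simp add: chain_term_def prod_nonneg)
  have inner: "((\<lambda>ks. (chain_term ns \<circ> snd) (k, ks)) has_sum ?c k) (?C k)" for k
    using has_sum_finite[OF finite_chains] by (simp add: series_coeff_mzv_word[OF assms])
  have img: "snd ` ?S = {ks. length ks = length ns \<and> (\<forall>k\<in>set ks. 1 \<le> k) \<and> sorted_wrt (<) ks}"
    by (force simp: chains_def simp del: last.simps)
  have inj: "inj_on snd ?S" by (auto simp: inj_on_def chains_def simp del: last.simps)
  have mzv: "mzv ns = infsum (chain_term ns \<circ> snd) ?S"
    unfolding mzv_def img[symmetric] chain_term_def[symmetric] using infsum_reindex[OF inj] by simp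
  show ?thesis
  proof (cases "summable ?c")
    case True
    then have sum: "(?c has_sum suminf ?c) UNIV"
      by (intro sums_nonneg_imp_has_sum summable_sums) (auto simp: series_coeff_nonneg)
    then have "(chain_term ns \<circ> snd) summable_on ?S"
      using inner pos by (intro summable_on_SigmaI[where g = ?c]) (auto dest: has_sum_imp_summable)
    then have "mzv ns = infsum (\<lambda>k. infsum (\<lambda>ks. (chain_term ns \<circ> snd) (k, ks)) (?C k)) UNIV"
      unfolding mzv by (rule infsum_Sigma_banach[symmetric])
    also have "\<dots> = infsum ?c UNIV" using infsumI[OF inner] by simp
    also have "\<dots> = suminf ?c" using sum by (rule infsumI)
    finally show ?thesis
      using True by (simp add: suminf_ennreal2 series_coeff_nonneg suminf_nonneg)
  next
    case False
    have "\<not> (chain_term ns \<circ> snd) summable_on ?S"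
    proof
      assume "(chain_term ns \<circ> snd) summable_on ?S"
      then have "(\<lambda>k. infsum (\<lambda>ks. (chain_term ns \<circ> snd) (k, ks)) (?C k)) summable_on UNIV"
        by (rule summable_on_SigmaD) (use inner in \<open>auto dest: has_sum_imp_summable\<close>)
      then have "?c summable_on UNIV" using infsumI[OF inner] by simp
      with False show False by (simp add: summable_on_UNIV_nonneg_real_iff series_coeff_nonneg)
    qed
    then have "mzv ns = 0" unfolding mzv by (rule infsum_not_exists)
    moreover have "(suminf (\<lambda>k. ennreal (?c k))) = top"
      using summable_suminf_not_top[of ?c] False series_coeff_nonneg by blast
    ultimately show ?thesis by simp
  qed
qed

text \<open>
The last exponent \<open>n\<close> is kept apart because appending a letter \<open>0\<close> increments it, whereas
appending a letter \<open>1\<close> starts a new exponent.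
\<close>

lemma ex_mzv_word:
  assumes "as \<noteq> []" "hd as"
  shows "\<exists>ns n. (\<forall>m\<in>set (ns @ [n]). 1 \<le> m) \<and> mzv_word (ns @ [n]) = as"
  using assms
proof (induction as rule: rev_induct)
  case (snoc a as)
  show ?case
  proof (cases "as = []")
    case True
    with snoc.prems show ?thesis
      by (intro exI[of _ "[]"] exI[of _ 1]) (simp add: mzv_word_def)
  next
    case False
    then obtain ns n where *: "\<forall>m\<in>set (ns @ [n]). 1 \<le> m" "mzv_word (ns @ [n]) = as"
      using snoc by auto
    show ?thesis
    proof (cases a)
      case True
      then show ?thesis
        using * by (intro exI[of _ "ns @ [n]"] exI[of _ 1]) (auto simp: mzv_word_def)
    next
      case False
      have "replicate n False = replicate (n - 1) False @ [False]"
        using *(1) by (cases n) (simp_all add: replicate_append_same)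
      then show ?thesis
        using * False by (intro exI[of _ ns] exI[of _ "Suc n"]) (auto simp: mzv_word_def)
    qed
  qed
qed simp

lemma convergent_word_iff:
  "convergent_word as \<longleftrightarrow> as = [] \<or> (\<exists>ns. mzv_admissible ns \<and> as = mzv_word ns)"
proof
  assume conv: "convergent_word as"
  show "as = [] \<or> (\<exists>ns. mzv_admissible ns \<and> as = mzv_word ns)"
  proof (cases "as = []")
    case False
    with conv obtain ns n where *: "\<forall>m\<in>set (ns @ [n]). 1 \<le> m" "mzv_word (ns @ [n]) = as"
      using ex_mzv_word[of as] by (auto simp: convergent_word_def)
    have "n \<noteq> 1"
      using conv False *(2) by (auto simp: convergent_word_def mzv_word_def)
    then have "mzv_admissible (ns @ [n])"
      using * by (auto simp: mzv_admissible_def)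
    with * show ?thesis by blast
  qed simp
next
  assume "as = [] \<or> (\<exists>ns. mzv_admissible ns \<and> as = mzv_word ns)"
  then show "convergent_word as"
  proof
    assume "\<exists>ns. mzv_admissible ns \<and> as = mzv_word ns"
    then obtain ns where ns: "mzv_admissible ns" "as = mzv_word ns" by blast
    obtain ms n where "ns = ms @ [n]"
      using ns(1) by (cases ns rule: rev_cases) (auto simp: mzv_admissible_def)
    then have "last as = False" "as \<noteq> []"
      using ns by (auto simp: mzv_admissible_def mzv_word_snoc)
    moreover have "hd as"
      using ns by (cases ns) (auto simp: mzv_admissible_def mzv_word_def)
    ultimately show ?thesis by (simp add: convergent_word_def)
  qed (simp add: convergent_word_def)
qed

lemma count_list_mzv_word: "count_list (mzv_word ns) True = length ns"
proof -
  have "count_list (replicate n False) True = 0" for n by (induction n) auto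
  then show ?thesis by (induction ns) (simp_all add: mzv_word_def)
qed

section \<open>Iterated integrals as power series\<close>

text \<open>
The simplex is scaled by \<open>x\<close> so that the integral can be computed by recursion: fixing the last
coordinate \<open>y\<close> leaves the simplex of one dimension less, scaled by \<open>y\<close>.
\<close>

definition simplex_condition :: "nat \<Rightarrow> real \<Rightarrow> (nat \<Rightarrow> real) \<Rightarrow> bool" where
  "simplex_condition n x t \<longleftrightarrow> (\<forall>k<n. 0 \<le> t k \<and> t k \<le> x) \<and> mono_on {..<n} t"

lemma mono_on_fun_upd_last:
  fixes t :: "nat \<Rightarrow> real"
  shows "mono_on {..<Suc n} (t(n := y)) \<longleftrightarrow> mono_on {..<n} t \<and> (\<forall>k<n. t k \<le> y)"
proof (intro iffI conjI allI impI)
  assume m: "mono_on {..<Suc n} (t(n := y))"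
  show "mono_on {..<n} t"
  proof (rule mono_onI)
    fix i j assume "i \<in> {..<n}" "j \<in> {..<n}" "i \<le> j"
    then show "t i \<le> t j" using mono_onD[OF m, of i j] by simp
  qed
  show "t k \<le> y" if "k < n" for k using mono_onD[OF m, of k n] that by simp
next
  assume m: "mono_on {..<n} t \<and> (\<forall>k<n. t k \<le> y)"
  show "mono_on {..<Suc n} (t(n := y))"
  proof (rule mono_onI)
    fix i j assume ij: "i \<in> {..<Suc n}" "j \<in> {..<Suc n}" "i \<le> j"
    show "(t(n := y)) i \<le> (t(n := y)) j"
    proof (cases "j = n")
      case True
      then show ?thesis using m ij by (cases "i = n") auto
    next
      case False
      then show ?thesis using m ij mono_onD[of "{..<n}" t i j] by simp
    qed
  qed
qed

lemma simplex_condition_Suc: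
  "simplex_condition (Suc n) x (t(n := y)) \<longleftrightarrow> 0 \<le> y \<and> y \<le> x \<and> simplex_condition n y t"
proof -
  have "(\<forall>k<Suc n. 0 \<le> (t(n := y)) k \<and> (t(n := y)) k \<le> x)
      \<longleftrightarrow> 0 \<le> y \<and> y \<le> x \<and> (\<forall>k<n. 0 \<le> t k \<and> t k \<le> x)"
    by (auto simp: less_Suc_eq)
  then show ?thesis
    unfolding simplex_condition_def mono_on_fun_upd_last using order_trans by blast
qed

definition kernel :: "bool \<Rightarrow> real \<Rightarrow> real" where
  "kernel a t = 1 / \<bar>t - of_bool a\<bar>"

definition simplex_integrand :: "bool list \<Rightarrow> real \<Rightarrow> (nat \<Rightarrow> real) \<Rightarrow> real" where
  "simplex_integrand as x t =
     (\<Prod>k<length as. kernel (as ! k) (t k)) * of_bool (simplex_condition (length as) x t)"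

lemma kernel_nonneg: "0 \<le> kernel a t"
  by (simp add: kernel_def)

lemma simplex_integrand_nonneg: "0 \<le> simplex_integrand as x t"
  by (simp add: simplex_integrand_def kernel_nonneg prod_nonneg)

lemma kernel_measurable [measurable]: "kernel a \<in> borel_measurable borel"
  unfolding kernel_def by measurable

lemma simplex_condition_measurable:
  "Measurable.pred (\<Pi>\<^sub>M k\<in>{..<n}. lborel) (simplex_condition n x)"
proof -
  have comp: "(\<lambda>t. t k) \<in> borel_measurable (\<Pi>\<^sub>M k\<in>{..<n}. (lborel :: real measure))"
    if "k \<in> {..<n}" for k
    using measurable_component_singleton[OF that, of "\<lambda>_. lborel :: real measure"] by simp
  let ?M = "\<Pi>\<^sub>M k\<in>{..<n}. (lborel :: real measure)"
  have le: "Measurable.pred ?M (\<lambda>t. i \<le> j \<longrightarrow> t i \<le> t j)"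
    if "i \<in> {..<n}" "j \<in> {..<n}" for i j
    unfolding pred_def
    by (cases "i \<le> j") (simp_all add: borel_measurable_le[OF comp[OF that(1)] comp[OF that(2)]])
  have bounds: "Measurable.pred ?M (\<lambda>t. 0 \<le> t k \<and> t k \<le> x)" if "k \<in> {..<n}" for k
    using borel_measurable_le[OF borel_measurable_const[of 0] comp[OF that]]
      borel_measurable_le[OF comp[OF that] borel_measurable_const[of x]]
    by (intro pred_intros_logic(3)) (simp_all only: pred_def)
  have "Measurable.pred ?M (\<lambda>t. (\<forall>k\<in>{..<n}. 0 \<le> t k \<and> t k \<le> x) \<and>
      (\<forall>i\<in>{..<n}. \<forall>j\<in>{..<n}. i \<le> j \<longrightarrow> t i \<le> t j))"
    by (rule pred_intros_logic(3); intro pred_intros_finite(3) finite_lessThan le bounds; assumption)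
  moreover have "simplex_condition n x = (\<lambda>t.
      (\<forall>k\<in>{..<n}. 0 \<le> t k \<and> t k \<le> x) \<and> (\<forall>i\<in>{..<n}. \<forall>j\<in>{..<n}. i \<le> j \<longrightarrow> t i \<le> t j))"
    unfolding simplex_condition_def mono_on_def fun_eq_iff by blast
  ultimately show ?thesis by (simp only:)
qed

lemma simplex_integrand_measurable:
  "simplex_integrand as x \<in> borel_measurable (\<Pi>\<^sub>M k\<in>{..<length as}. lborel)"
proof -
  have factor: "(\<lambda>t. kernel (as ! k) (t k))
      \<in> borel_measurable (\<Pi>\<^sub>M k\<in>{..<length as}. (lborel :: real measure))" if "k \<in> {..<length as}" for k
    using measurable_component_singleton[OF that, of "\<lambda>_. lborel :: real measure"]
    by (intro measurable_compose[OF _ kernel_measurable]) simp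
  have "(\<lambda>t. if simplex_condition (length as) x t then 1 else 0 :: real)
      \<in> borel_measurable (\<Pi>\<^sub>M k\<in>{..<length as}. lborel)"
    using simplex_condition_measurable by (intro measurable_If) (auto simp: pred_def)
  then show ?thesis
    unfolding simplex_integrand_def of_bool_def
    by (intro borel_measurable_times borel_measurable_prod factor)
qed

definition simplex_integral :: "bool list \<Rightarrow> real \<Rightarrow> ennreal" where
  "simplex_integral as x =
     (\<integral>\<^sup>+ t. ennreal (simplex_integrand as x t) \<partial>(\<Pi>\<^sub>M k\<in>{..<length as}. lborel))"

lemma simplex_integrand_append1:
  "simplex_integrand (as @ [a]) x (t(length as := y)) =
    kernel a y * indicator {0..x} y * simplex_integrand as y t"
proof -
  have "(\<Prod>k<length as. kernel ((as @ [a]) ! k) ((t(length as := y)) k))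
      = (\<Prod>k<length as. kernel (as ! k) (t k))"
    by (rule prod.cong) (auto simp: nth_append)
  then show ?thesis
    by (auto simp: simplex_integrand_def simplex_condition_Suc indicator_def)
qed

interpretation lborel_product: product_sigma_finite "\<lambda>_ :: nat. lborel :: real measure" ..

lemma simplex_integral_Nil: "simplex_integral [] x = 1"
  by (simp add: simplex_integral_def simplex_integrand_def simplex_condition_def
      PiM_empty)

lemma simplex_integral_append1:
  "simplex_integral (as @ [a]) x =
    (\<integral>\<^sup>+ y. ennreal (kernel a y) * indicator {0..x} y * simplex_integral as y \<partial>lborel)"
proof -
  let ?n = "length as"
  let ?P = "\<lambda>I. \<Pi>\<^sub>M k\<in>I. (lborel :: real measure)"
  have ins: "{..<length (as @ [a])} = insert ?n {..<?n}" by auto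
  have meas: "(\<lambda>t. ennreal (simplex_integrand (as @ [a]) x t))
      \<in> borel_measurable (?P (insert ?n {..<?n}))"
    using simplex_integrand_measurable[of "as @ [a]" x] unfolding ins by measurable
  have meas': "(\<lambda>t. ennreal (simplex_integrand as y t)) \<in> borel_measurable (?P {..<?n})" for y
    using simplex_integrand_measurable[of as y] by measurable
  have "simplex_integral (as @ [a]) x =
      (\<integral>\<^sup>+ y. \<integral>\<^sup>+ t. ennreal (simplex_integrand (as @ [a]) x (t(?n := y))) \<partial>?P {..<?n} \<partial>lborel)"
    unfolding simplex_integral_def ins
    using meas by (intro lborel_product.product_nn_integral_insert_rev) auto
  also have "\<dots> = (\<integral>\<^sup>+ y. \<integral>\<^sup>+ t. ennreal (kernel a y) * indicator {0..x} y *
      ennreal (simplex_integrand as y t) \<partial>?P {..<?n} \<partial>lborel)"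
    unfolding simplex_integrand_append1
    by (simp add: ennreal_mult simplex_integrand_nonneg kernel_nonneg ennreal_indicator)
  also have "\<dots> = (\<integral>\<^sup>+ y. ennreal (kernel a y) * indicator {0..x} y * simplex_integral as y \<partial>lborel)"
    unfolding simplex_integral_def by (simp add: nn_integral_cmult meas')
  finally show ?thesis .
qed

lemma nn_integral_monomial:
  assumes "0 \<le> x" "0 \<le> c"
  shows "(\<integral>\<^sup>+ y. ennreal (c * y ^ m) * indicator {0..x} y \<partial>lborel)
    = ennreal (c / real (Suc m) * x ^ Suc m)"
proof -
  have "(\<integral>\<^sup>+ y. ennreal (c * y ^ m) * indicator {0..x} y \<partial>lborel)
      = ennreal (c / real (Suc m) * x ^ Suc m - c / real (Suc m) * 0 ^ Suc m)"
  proof (rule nn_integral_FTC_Icc)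
    show "((\<lambda>y. c / real (Suc m) * y ^ Suc m) has_real_derivative c * y ^ m) (at y)" for y
      using DERIV_cmult[OF DERIV_pow[of "Suc m" y], of "c / real (Suc m)"]
      by (simp del: of_nat_Suc)
  qed (use assms in auto)
  then show ?thesis by simp
qed

lemma suminf_swap_ennreal:
  fixes f :: "nat \<Rightarrow> nat \<Rightarrow> ennreal"
  shows "(suminf (\<lambda>i. suminf (\<lambda>j. f i j))) = suminf (\<lambda>j. suminf (\<lambda>i. f i j))"
  using nn_integral_suminf[of "\<lambda>j i. f i j" "count_space UNIV"]
  by (simp add: nn_integral_count_space_nat)

text \<open>
The Cauchy product with \<open>1 / (1 - y) = (\<Sum>i. y ^ i)\<close>, by interchanging two sums of nonnegative terms.
\<close>

lemma geometric_kernel_series: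
  fixes c :: "nat \<Rightarrow> real"
  assumes "\<And>k. 0 \<le> c k" "0 \<le> y" "y < 1"
  shows "ennreal (kernel True y) * suminf (\<lambda>k. ennreal (c k * y ^ k))
    = suminf (\<lambda>m. ennreal ((\<Sum>j<Suc m. c j) * y ^ m))"
proof -
  have geo: "ennreal (kernel True y) * ennreal (c k * y ^ k)
      = suminf (\<lambda>m. ennreal (if k \<le> m then c k * y ^ m else 0))" for k
  proof -
    have "(\<lambda>i. (c k * y ^ k) * y ^ i) sums ((c k * y ^ k) * (1 / (1 - y)))"
      using assms by (intro sums_mult geometric_sums) simp
    then have "(\<lambda>i. if k \<le> i + k then c k * y ^ (i + k) else 0) sums ((c k * y ^ k) * (1 / (1 - y)))"
      by (simp add: power_add mult_ac)
    then have "(\<lambda>m. if k \<le> m then c k * y ^ m else 0) sums ((c k * y ^ k) * (1 / (1 - y)))"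
      by (subst (asm) sums_iff_shift) (simp add: sum.neutral)
    then have "suminf (\<lambda>m. ennreal (if k \<le> m then c k * y ^ m else 0))
        = ennreal ((c k * y ^ k) * (1 / (1 - y)))"
      using assms by (intro suminf_ennreal_eq) auto
    also have "\<dots> = ennreal (kernel True y) * ennreal (c k * y ^ k)"
      using assms by (subst ennreal_mult[symmetric]) (auto simp: kernel_def mult.commute)
    finally show ?thesis by simp
  qed
  have "ennreal (kernel True y) * suminf (\<lambda>k. ennreal (c k * y ^ k))
      = suminf (\<lambda>k. suminf (\<lambda>m. ennreal (if k \<le> m then c k * y ^ m else 0)))"
    unfolding geo[symmetric] by simp
  also have "\<dots> = suminf (\<lambda>m. suminf (\<lambda>k. ennreal (if k \<le> m then c k * y ^ m else 0)))"
    by (rule suminf_swap_ennreal)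
  also have "\<dots> = suminf (\<lambda>m. ennreal ((\<Sum>j<Suc m. c j) * y ^ m))"
  proof (rule arg_cong[where f = suminf], rule ext)
    fix m
    have "suminf (\<lambda>k. ennreal (if k \<le> m then c k * y ^ m else 0))
        = (\<Sum>k\<in>{..<Suc m}. ennreal (if k \<le> m then c k * y ^ m else 0))"
      by (rule suminf_finite) auto
    also have "\<dots> = (\<Sum>k\<in>{..<Suc m}. ennreal (c k * y ^ m))"
      by (rule sum.cong) auto
    also have "\<dots> = ennreal (\<Sum>k\<in>{..<Suc m}. c k * y ^ m)"
      using assms by (intro sum_ennreal) simp
    finally show "suminf (\<lambda>k. ennreal (if k \<le> m then c k * y ^ m else 0))
        = ennreal ((\<Sum>j<Suc m. c j) * y ^ m)"
      by (simp only: sum_distrib_right)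
  qed
  finally show ?thesis .
qed

text \<open>
The pole of \<open>1 / y\<close> is harmless because the series has no constant term.
\<close>

lemma kernel_False_series:
  fixes c :: "nat \<Rightarrow> real"
  assumes "\<And>k. 0 \<le> c k" "0 < y" "c 0 = 0"
  shows "ennreal (kernel False y) * suminf (\<lambda>k. ennreal (c k * y ^ k))
    = suminf (\<lambda>m. ennreal (c (Suc m) * y ^ m))"
proof -
  have "ennreal (kernel False y) * suminf (\<lambda>k. ennreal (c k * y ^ k))
      = suminf (\<lambda>k. ennreal (kernel False y * (c k * y ^ k)))"
  proof -
    have "ennreal (kernel False y * (c k * y ^ k)) = ennreal (kernel False y) * ennreal (c k * y ^ k)"
      for k using assms by (intro ennreal_mult) (auto simp: kernel_nonneg)
    then show ?thesis by simp
  qed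
  also have "\<dots> = suminf (\<lambda>m. ennreal (kernel False y * (c (Suc m) * y ^ Suc m)))"
    using suminf_offset[of "\<lambda>k. ennreal (kernel False y * (c k * y ^ k))" 1] assms(3) by simp
  also have "\<dots> = suminf (\<lambda>m. ennreal (c (Suc m) * y ^ m))"
    using assms(2) by (simp add: kernel_def field_simps)
  finally show ?thesis .
qed

text \<open>
A first letter \<open>0\<close> would integrate \<open>dt / t\<close> against the constant series \<open>1\<close>, which diverges at \<open>0\<close>.
After a first letter \<open>1\<close> the constant term vanishes, and integration term by term is allowed by monotone
convergence.
\<close>

lemma simplex_integral_series:
  assumes "as = [] \<or> hd as" "0 \<le> x" "x \<le> 1"
  shows "simplex_integral as x = suminf (\<lambda>k. ennreal (series_coeff as k * x ^ k))"
  using assms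
proof (induction as arbitrary: x rule: rev_induct)
  case Nil
  have "suminf (\<lambda>k. ennreal (series_coeff [] k * x ^ k))
      = (\<Sum>k\<in>{0}. ennreal (series_coeff [] k * x ^ k))"
    by (rule suminf_finite) (auto simp: series_coeff_Nil)
  then show ?case by (simp add: simplex_integral_Nil series_coeff_Nil)
next
  case (snoc a as)
  let ?c = "series_coeff as"
  \<comment> \<open>the coefficients of the integrand; those of the integral are shifted by one and divided by the new index\<close>
  define b where "b m = real (Suc m) * series_coeff (as @ [a]) (Suc m)" for m
  have b_nonneg: "0 \<le> b m" for m by (simp add: b_def series_coeff_nonneg)
  have IH: "simplex_integral as y = suminf (\<lambda>k. ennreal (?c k * y ^ k))" if "0 \<le> y" "y \<le> x" for y
  proof (rule snoc.IH)
    show "as = [] \<or> hd as" using snoc.prems(1) by (cases "as = []") simp_all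
  qed (use that snoc.prems in auto)
  \<comment> \<open>the kernels have the value \<open>0\<close> instead of \<open>\<infinity>\<close> at their poles \<open>0\<close> and \<open>1\<close>, which therefore are excluded\<close>
  have ae: "AE y in lborel. ennreal (kernel a y) * indicator {0..x} y * simplex_integral as y
      = suminf (\<lambda>m. ennreal (b m * y ^ m) * indicator {0..x} y)"
    using AE_lborel_singleton[of 0] AE_lborel_singleton[of 1]
  proof eventually_elim
    case (elim y)
    show ?case
    proof (cases "y \<in> {0..x}")
      case True
      then have y: "0 < y" "y < 1" "y \<le> x" using elim snoc.prems by auto
      have "ennreal (kernel a y) * suminf (\<lambda>k. ennreal (?c k * y ^ k))
          = suminf (\<lambda>m. ennreal (b m * y ^ m))"
      proof (cases a)
        case True
        then have a: "a = True" by simp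
        have b: "b = (\<lambda>m. \<Sum>j<Suc m. ?c j)"
          by (rule ext) (simp add: b_def series_coeff_append1 a del: of_nat_Suc sum.lessThan_Suc)
        show ?thesis
          unfolding a b using y by (intro geometric_kernel_series) (simp_all add: series_coeff_nonneg)
      next
        case False
        then have a: "a = False" by simp
        have b: "b = (\<lambda>m. ?c (Suc m))"
          by (rule ext) (simp add: b_def series_coeff_append1 a del: of_nat_Suc)
        have "?c 0 = 0"
          using snoc.prems(1) a by (intro series_coeff_zero) auto
        then show ?thesis
          unfolding a b using y by (intro kernel_False_series) (simp_all add: series_coeff_nonneg)
      qed
      then show ?thesis using True y IH[of y] by simp
    qed simp
  qed
  have "simplex_integral (as @ [a]) x
      = (\<integral>\<^sup>+ y. suminf (\<lambda>m. ennreal (b m * y ^ m) * indicator {0..x} y) \<partial>lborel)"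
    unfolding simplex_integral_append1 by (rule nn_integral_cong_AE[OF ae])
  also have "\<dots> = suminf (\<lambda>m. \<integral>\<^sup>+ y. ennreal (b m * y ^ m) * indicator {0..x} y \<partial>lborel)"
    by (rule nn_integral_suminf) measurable
  also have "\<dots> = suminf (\<lambda>m. ennreal (b m / real (Suc m) * x ^ Suc m))"
    using snoc.prems b_nonneg by (simp only: nn_integral_monomial)
  also have "\<dots> = suminf (\<lambda>m. ennreal (series_coeff (as @ [a]) (Suc m) * x ^ Suc m))"
    by (simp add: b_def del: of_nat_Suc)
  also have "\<dots> = suminf (\<lambda>k. ennreal (series_coeff (as @ [a]) k * x ^ k))"
    using suminf_offset[of "\<lambda>k. ennreal (series_coeff (as @ [a]) k * x ^ k)" 1]
    by (simp add: series_coeff_zero)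
  finally show ?case .
qed

text \<open>
On the simplex every letter \<open>1\<close> contributes a negative factor and every letter \<open>0\<close> a positive one,
so the sign of the integrand is constant.
\<close>

lemma prod_signed_kernel:
  assumes "\<forall>k<length as. 0 \<le> t k \<and> t k \<le> 1"
  shows "(\<Prod>k<length as. 1 / (t k - of_bool (as ! k)))
    = (-1) ^ count_list as True * (\<Prod>k<length as. kernel (as ! k) (t k))"
  using assms
proof (induction as rule: rev_induct)
  case (snoc a as)
  have eq: "(\<Prod>k<length as. f ((as @ [a]) ! k) (t k)) = (\<Prod>k<length as. f (as ! k) (t k))"
    for f :: "bool \<Rightarrow> real \<Rightarrow> real"
    by (rule prod.cong) (auto simp: nth_append)
  have IH: "(\<Prod>k<length as. 1 / (t k - of_bool (as ! k)))
    = (-1) ^ count_list as True * (\<Prod>k<length as. kernel (as ! k) (t k))"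
    using snoc by simp
  have "0 \<le> t (length as)" "t (length as) \<le> 1" using snoc.prems by auto
  then have "1 / (t (length as) - of_bool a) = (if a then -1 else 1) * kernel a (t (length as))"
    by (auto simp: kernel_def abs_if divide_simps)
  then show ?case
    using IH eq[of "\<lambda>b s. 1 / (s - of_bool b)"] eq[of kernel] by simp
qed simp

lemma iterated_integral_eq:
  "iterated_integral as = (-1) ^ count_list as True * enn2real (simplex_integral as 1)"
proof -
  let ?M = "\<Pi>\<^sub>M k\<in>{..<length as}. (lborel :: real measure)"
  have "iterated_integral as
      = (\<integral>t. (-1) ^ count_list as True * simplex_integrand as 1 t \<partial>?M)"
    unfolding iterated_integral_def set_lebesgue_integral_def
  proof (intro Bochner_Integration.integral_cong refl)
    fix t :: "nat \<Rightarrow> real"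
    show "indicat_real {t. (\<forall>k<length as. 0 \<le> t k \<and> t k \<le> 1) \<and> mono_on {..<length as} t} t *\<^sub>R
        (\<Prod>k<length as. 1 / (t k - of_bool (as ! k)))
        = (-1) ^ count_list as True * simplex_integrand as 1 t"
    proof (cases "simplex_condition (length as) 1 t")
      case True
      then show ?thesis using prod_signed_kernel[of as t]
        by (simp add: simplex_integrand_def simplex_condition_def)
    next
      case False
      then show ?thesis by (simp add: simplex_integrand_def simplex_condition_def)
    qed
  qed
  also have "\<dots> = (-1) ^ count_list as True * (\<integral>t. simplex_integrand as 1 t \<partial>?M)"
    by simp
  also have "(\<integral>t. simplex_integrand as 1 t \<partial>?M) = enn2real (simplex_integral as 1)"
    unfolding simplex_integral_def
    using simplex_integrand_measurable by (intro integral_eq_nn_integral) (auto simp: simplex_integrand_nonneg)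
  finally show ?thesis .
qed

lemma iterated_integral_Nil: "iterated_integral [] = 1"
  by (simp add: iterated_integral_eq simplex_integral_Nil)

lemma iterated_integral_mzv_word:
  assumes "mzv_admissible ns"
  shows "iterated_integral (mzv_word ns) = (-1) ^ length ns * mzv ns"
proof -
  have "mzv_word ns = [] \<or> hd (mzv_word ns)"
    by (cases ns) (auto simp: mzv_word_def)
  then have "simplex_integral (mzv_word ns) 1 = suminf (\<lambda>k. ennreal (series_coeff (mzv_word ns) k))"
    using simplex_integral_series[of "mzv_word ns" 1] by simp
  then show ?thesis
    using assms
    by (simp add: iterated_integral_eq count_list_mzv_word mzv_eq_series mzv_admissible_def)
qed

section \<open>Block encoding\<close>

text \<open>
The minimal factorisation cuts a word exactly between two equal neighbouring letters. The recursion
inserts these cuts from the right; \<open>hd\<close> and \<open>tl\<close> are applied to non-empty lists only.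
\<close>

fun split_blocks :: "bool list \<Rightarrow> bool list list" where
  "split_blocks [] = []"
| "split_blocks [x] = [[x]]"
| "split_blocks (x # y # w) =
     (if x = y then [x] # split_blocks (y # w)
      else (x # hd (split_blocks (y # w))) # tl (split_blocks (y # w)))"

lemma split_blocks_Cons: "\<exists>b bs. split_blocks (x # w) = (x # b) # bs"
  by (induction w arbitrary: x) auto

lemma alternating_single: "alternating [x]"
  by (auto simp: alternating_def sublist_def append_eq_Cons_conv)

lemma alternating_Cons_Cons: "alternating (x # y # w) \<longleftrightarrow> x \<noteq> y \<and> alternating (y # w)"
  by (auto simp: alternating_def sublist_Cons_right)

lemma split_blocks_factorisation:
  "concat (split_blocks w) = w \<and> (\<forall>v\<in>set (split_blocks w). alternating v)"
proof (induction w rule: split_blocks.induct)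
  case (3 x y w)
  obtain b bs where "split_blocks (y # w) = (y # b) # bs" using split_blocks_Cons by blast
  with 3 show ?case by (auto simp: alternating_single alternating_Cons_Cons)
qed (auto simp: alternating_single)

text \<open>
Every factorisation into alternating words must cut between two equal letters. A further
cut between different letters adds a block, so that the minimum is attained only once. Uniqueness is
needed because \<open>block_factorisation\<close> is an unspecified minimiser.
\<close>

lemma split_blocks_minimal:
  assumes "concat ws = w" "\<forall>v\<in>set ws. alternating v"
  shows "length (split_blocks w) \<le> length ws \<and>
    (length ws = length (split_blocks w) \<longrightarrow> ws = split_blocks w)"
  using assms
proof (induction w arbitrary: ws rule: split_blocks.induct)
  case 1
  then have "ws = []" by (cases ws) (auto simp: alternating_def)
  then show ?case by simp
next
  case (2 x)
  then obtain f rest where ws: "ws = f # rest" "f \<noteq> []" by (cases ws) (auto simp: alternating_def)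
  with 2 have "f = [x]" "concat rest = []" by (auto simp: append_eq_Cons_conv)
  moreover from this ws 2 have "rest = []" by (cases rest) (auto simp: alternating_def)
  ultimately show ?case using ws by simp
next
  case (3 x y w)
  then obtain f rest where ws: "ws = f # rest" "f \<noteq> []" by (cases ws) (auto simp: alternating_def)
  with 3 obtain g where f: "f = x # g" and cat: "g @ concat rest = y # w"
    by (cases f) auto
  obtain b bs where sb: "split_blocks (y # w) = (y # b) # bs" using split_blocks_Cons by blast
  show ?case
  proof (cases "g = []")
    case True
    have IH: "length (split_blocks (y # w)) \<le> length rest \<and>
      (length rest = length (split_blocks (y # w)) \<longrightarrow> rest = split_blocks (y # w))"
      using 3 ws cat True by (cases "x = y") auto
    then show ?thesis using ws f True sb by auto
  next
    case False
    then obtain g' where g: "g = y # g'" using cat by (cases g) auto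
    have "alternating (x # y # g')" using 3 ws f g by simp
    then have xy: "x \<noteq> y" and "alternating g"
      unfolding g alternating_Cons_Cons by blast+
    then have "length (split_blocks (y # w)) \<le> length (g # rest) \<and>
      (length (g # rest) = length (split_blocks (y # w)) \<longrightarrow> g # rest = split_blocks (y # w))"
      using 3 ws cat by (intro 3(2)) auto
    then show ?thesis using ws f xy sb by auto
  qed
qed

lemma block_factorisation_eq: "block_factorisation w = split_blocks w"
proof -
  let ?P = "\<lambda>ws. concat ws = w \<and> (\<forall>v\<in>set ws. alternating v)"
  have "is_arg_min length ?P (arg_min length ?P)"
    using split_blocks_factorisation[of w] by (intro is_arg_min_arg_min_nat)
  then have P: "?P (block_factorisation w)"
    and "\<not> length (split_blocks w) < length (block_factorisation w)"
    using split_blocks_factorisation[of w] by (auto simp: is_arg_min_def block_factorisation_def)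
  with split_blocks_minimal[of "block_factorisation w" w] show ?thesis by force
qed

text \<open>
Building the word from the right: a letter equal to the first one opens a new block of length \<open>1\<close>, and
the opposite letter lengthens the first block by \<open>1\<close>. The first letter \<open>b\<close> can be prescribed because
exchanging the two letters preserves the blocks.
\<close>

lemma ex_split_blocks_lengths:
  assumes "ns \<noteq> []" "\<forall>n\<in>set ns. 1 \<le> n"
  shows "\<exists>w. hd w = b \<and> w \<noteq> [] \<and> map length (split_blocks w) = ns"
  using assms
proof (induction "sum_list ns" arbitrary: ns b rule: less_induct)
  case less
  then obtain n ms where ns: "ns = n # ms" "1 \<le> n" by (cases ns) auto
  show ?case
  proof (cases "n = 1")
    case True
    show ?thesis
    proof (cases "ms = []")
      case True
      then show ?thesis using \<open>n = 1\<close> ns by (intro exI[of _ "[b]"]) simp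
    next
      case False
      have "\<exists>w. hd w = b \<and> w \<noteq> [] \<and> map length (split_blocks w) = ms"
        using False less(3) ns by (intro less(1)) auto
      then obtain w where w: "hd w = b" "w \<noteq> []" "map length (split_blocks w) = ms" by blast
      obtain w' where "w = b # w'" using w(1,2) by (cases w) auto
      with w ns True show ?thesis by (intro exI[of _ "b # w"]) auto
    qed
  next
    case False
    define c where "c = (\<not> b)"
    have "\<exists>w. hd w = c \<and> w \<noteq> [] \<and> map length (split_blocks w) = (n - 1) # ms"
    proof (rule less(1))
      show "sum_list ((n - 1) # ms) < sum_list ns" using ns by simp
      show "\<forall>m\<in>set ((n - 1) # ms). 1 \<le> m" using less(3) ns False by auto
    qed simp
    then obtain w where w: "hd w = c" "w \<noteq> []" "map length (split_blocks w) = (n - 1) # ms"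
      by (elim exE conjE)
    obtain w' where w': "w = c # w'" using w(1,2) by (cases w) auto
    obtain d ds where d: "split_blocks w = (c # d) # ds"
      using split_blocks_Cons[of c w'] unfolding w' by (elim exE)
    then have "split_blocks (b # w) = (b # c # d) # ds"
      by (simp add: w' c_def)
    moreover have "Suc (Suc (length d)) = n" "map length ds = ms"
      using w(3) d False ns(2) by simp_all
    ultimately have "map length (split_blocks (b # w)) = ns"
      by (simp add: ns(1))
    then show ?thesis by (intro exI[of _ "b # w"]) simp
  qed
qed

lemma block_encode_surj:
  assumes "ls \<noteq> []"
  obtains w where "w \<noteq> []" "\<not> hd w" "block_encode w = ls"
proof -
  obtain w where w: "hd w = False" "w \<noteq> []" "map length (split_blocks w) = map idx ls"
    using ex_split_blocks_lengths[of "map idx ls" False] idx assms by fastforce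
  have "block_encode w = map z (map length (split_blocks w))"
    by (simp add: block_encode_def block_factorisation_eq)
  also have "\<dots> = ls" by (simp add: w(3) o_def idx_inverse)
  finally show thesis using w(1,2) by (intro that) auto
qed

section \<open>Non-Lyndon words as maximal shuffles\<close>

text \<open>
The number with digits \<open>d\<close> in base \<open>B\<close>, most significant digit first. Digits are real, so that a
constant can be subtracted from all of them.
\<close>

primrec radix_value :: "('a \<Rightarrow> real) \<Rightarrow> real \<Rightarrow> 'a list \<Rightarrow> real" where
  "radix_value d B [] = 0"
| "radix_value d B (a # w) = d a * B ^ length w + radix_value d B w"

lemma radix_value_append:
  "radix_value d B (x @ y) = radix_value d B x * B ^ length y + radix_value d B y"
  by (induction x) (simp_all add: algebra_simps power_add)

text \<open>
Since \<open>B ^ n - 1\<close> is the number with \<open>n\<close> digits \<open>B - 1\<close>, shifting all digits by a constant does not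
affect comparisons between words of the same length.
\<close>

lemma radix_value_shift:
  "radix_value (\<lambda>a. d a - c * (B - 1)) B w = radix_value d B w - c * (B ^ length w - 1)"
  by (induction w) (simp_all add: algebra_simps)

text \<open>
In a shuffle, each letter of \<open>u\<close> or \<open>v\<close> is scaled by a power of \<open>B\<close> that depends on how many letters
of the other word follow. Partial summation bounds the total: delaying \<open>u\<close> shrinks its tails, which are
nonnegative, and moving \<open>v\<close> forward enlarges its heads, which are nonpositive. The number \<open>e\<close> is the
value of the letters of \<open>v\<close> that have already been placed; it makes the statement inductive and is
\<open>0\<close> in the application.
\<close>

lemma shuffles_radix_value_le:
  fixes d :: "'a \<Rightarrow> real"
  assumes "s \<in> shuffles u v" and "1 \<le> B"
    and "\<And>x. suffix x u \<Longrightarrow> 0 \<le> radix_value d B x"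
    and "\<And>p. prefix p v \<Longrightarrow> e * B ^ length p + radix_value d B p \<le> 0"
  shows "e * B ^ length s + radix_value d B s \<le> radix_value d B u * B ^ length v"
  using assms
proof (induction u v arbitrary: s e rule: shuffles.induct)
  case (1 v)
  then show ?case by simp
next
  case (2 u)
  have "e \<le> 0" using 2(4)[of "[]"] by simp
  then show ?case using 2(1,2) by (simp add: mult_nonpos_nonneg)
next
  case (3 a u b v)
  have e: "e \<le> 0" using 3(6)[of "[]"] by simp
  have lens: "length s = length u + length v + 2"
    using 3(3) length_shuffles[of s "a # u" "b # v"] by simp
  from 3(3) consider t where "s = a # t" "t \<in> shuffles u (b # v)"
    | t where "s = b # t" "t \<in> shuffles (a # u) v"
    by auto
  then show ?case
  proof cases
    case 1
    have IH: "e * B ^ length t + radix_value d B t \<le> radix_value d B u * B ^ length (b # v)"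
      using 3(4-6) by (intro 3(1)[OF 1(2)]) (auto intro: suffix_ConsI)
    have "B ^ length t \<le> B ^ length s"
      using 1(1) 3(4) by (simp add: mult_ge1_I)
    then have "e * B ^ length s \<le> e * B ^ length t"
      using e by (rule mult_left_mono_neg)
    moreover have "length t = length u + length (b # v)"
      using lens 1(1) by simp
    ultimately show ?thesis
      using IH 1(1) by (simp add: algebra_simps power_add)
  next
    case 2
    have IH: "(e * B + d b) * B ^ length t + radix_value d B t
        \<le> radix_value d B (a # u) * B ^ length v"
    proof (rule 3(2)[OF 2(2) 3(4,5)])
      fix p assume "prefix p v"
      then show "(e * B + d b) * B ^ length p + radix_value d B p \<le> 0"
        using 3(6)[of "b # p"] by (simp add: algebra_simps)
    qed
    have "0 \<le> radix_value d B (a # u) * B ^ length v"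
      using 3(5)[of "a # u"] 3(4) by (intro mult_nonneg_nonneg) auto
    then have "radix_value d B (a # u) * B ^ length v * 1
        \<le> radix_value d B (a # u) * B ^ length v * B"
      using 3(4) by (intro mult_left_mono)
    then show ?thesis
      using IH 2(1) by (simp add: algebra_simps)
  qed
qed

lemma radix_value_nonneg:
  assumes "\<And>a. a \<in> set w \<Longrightarrow> 0 \<le> d a" "0 \<le> B"
  shows "0 \<le> radix_value d B w"
  using assms by (induction w) simp_all

lemma radix_value_less_power:
  assumes "\<And>a. a \<in> set w \<Longrightarrow> d a \<le> B - 1" "1 \<le> B"
  shows "radix_value d B w < B ^ length w"
  using assms
proof (induction w)
  case (Cons a w)
  then have "d a * B ^ length w \<le> (B - 1) * B ^ length w"
    by (intro mult_right_mono) auto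
  with Cons show ?case by (simp add: algebra_simps)
qed simp

locale digits =
  fixes d :: "'a \<Rightarrow> nat" and A :: "'a set" and B :: nat
  assumes d_less: "a \<in> A \<Longrightarrow> d a < B" and inj: "inj_on d A" and B2: "2 \<le> B"
begin

abbreviation val :: "'a list \<Rightarrow> real" where
  "val \<equiv> radix_value (\<lambda>a. real (d a)) (real B)"

lemma val_less:
  assumes "set x \<subseteq> A" "d a < d b" "length x = length y"
  shows "val (p @ a # x) < val (p @ b # y)"
proof -
  have "real (d i) \<le> real B - 1" if "i \<in> set x" for i
    using d_less[of i] that assms(1) by auto
  then have "val x < real B ^ length x"
    using B2 by (intro radix_value_less_power) auto
  moreover have "real (d a) * real B ^ length x + real B ^ length x
      \<le> real (d b) * real B ^ length x"
    using mult_right_mono[of "real (d a) + 1" "real (d b)" "real B ^ length x"] assms(2)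
    by (simp add: algebra_simps)
  moreover have "0 \<le> val y"
    by (rule radix_value_nonneg) auto
  ultimately show ?thesis
    using assms(3) by (simp add: radix_value_append)
qed

lemma val_inj:
  assumes "set x \<subseteq> A" "set y \<subseteq> A" "length x = length y" "val x = val y"
  shows "x = y"
proof (rule ccontr)
  assume neq: "x \<noteq> y"
  obtain p a b x' y' where *: "x = p @ a # x'" "y = p @ b # y'" "a \<noteq> b"
    using same_length_different[OF neq assms(3)] by auto
  with assms(1,2) inj have "d a \<noteq> d b" by (auto dest: inj_onD)
  then show False
    using val_less[of x' a b y' p] val_less[of y' b a x' p] * assms by (auto simp: neq_iff)
qed

text \<open>
The periodic word \<open>x x x \<dots>\<close> read as a fraction in base \<open>B\<close>. For non-empty words, \<open>slope x \<le> slope y\<close> holds if and only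
if \<open>val (x @ y) \<le> val (y @ x)\<close>.
\<close>

definition slope :: "'a list \<Rightarrow> real" where
  "slope x = val x / (real B ^ length x - 1)"

text \<open>
The value after a shift of all digits that turns the periodic word of slope \<open>c\<close> into zero; its sign
tells on which side of \<open>c\<close> the slope lies.
\<close>

abbreviation excess :: "real \<Rightarrow> 'a list \<Rightarrow> real" where
  "excess c \<equiv> radix_value (\<lambda>a. real (d a) - c * (real B - 1)) (real B)"

lemma excess_slope:
  assumes "x \<noteq> []"
  shows "excess c x = (slope x - c) * (real B ^ length x - 1)" and "1 < real B ^ length x"
proof -
  show "1 < real B ^ length x"
    using assms B2 by (intro one_less_power) auto
  then show "excess c x = (slope x - c) * (real B ^ length x - 1)"
    by (simp only: radix_value_shift slope_def) (simp add: field_simps)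
qed

lemma excess_nonneg_iff: "x \<noteq> [] \<Longrightarrow> 0 \<le> excess c x \<longleftrightarrow> c \<le> slope x"
  using excess_slope(1)[of x c] excess_slope(2)[of x] by (simp add: zero_le_mult_iff)

lemma excess_pos_iff: "x \<noteq> [] \<Longrightarrow> 0 < excess c x \<longleftrightarrow> c < slope x"
  using excess_slope(1)[of x c] excess_slope(2)[of x] by (simp add: zero_less_mult_iff)

lemma excess_zero: "excess (slope x) x = 0"
  using excess_slope(1)[of x "slope x"] by (cases "x = []") auto

text \<open>
Shifting the digits by means of \<open>c = slope v\<close> gives \<open>v\<close> the value \<open>0\<close> and every suffix of \<open>u @ v\<close> a
nonnegative value. By concatenation, suffixes of \<open>u\<close> then have nonnegative and prefixes of \<open>v\<close>
nonpositive value, which are the conditions for \<open>u @ v\<close> to be the largest shuffle.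
\<close>

lemma val_shuffle_le:
  assumes min: "\<And>x. suffix x (u @ v) \<Longrightarrow> x \<noteq> [] \<Longrightarrow> slope v \<le> slope x"
    and s: "s \<in> shuffles u v"
  shows "val s \<le> val (u @ v)"
proof -
  let ?e = "excess (slope v)"
  have B: "1 \<le> real B" using B2 by simp
  have Bpos: "0 < real B ^ n" for n using B by (intro zero_less_power) simp
  have ge: "0 \<le> ?e x" if "suffix x (u @ v)" for x
    using min[OF that] by (cases "x = []") (auto simp: excess_nonneg_iff)
  have "0 * real B ^ length s + ?e s \<le> ?e u * real B ^ length v"
  proof (rule shuffles_radix_value_le[OF s B])
    fix x assume "suffix x u"
    then have "0 \<le> ?e (x @ v)" by (intro ge) (auto simp: suffix_def)
    then show "0 \<le> ?e x"
      using Bpos[of "length v"] by (simp add: radix_value_append excess_zero zero_le_mult_iff)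
  next
    fix p assume "prefix p v"
    then obtain q where v: "v = p @ q" by (auto simp: prefix_def)
    then have "0 \<le> ?e q" by (intro ge) (auto simp: suffix_def)
    moreover have "?e p * real B ^ length q + ?e q = 0"
      using excess_zero[of v] unfolding v radix_value_append[symmetric] by simp
    ultimately have "?e p * real B ^ length q \<le> 0" by simp
    moreover have "0 < real B ^ length q" using B2 by simp
    ultimately have "?e p \<le> 0" by (simp add: mult_le_0_iff)
    then show "0 * real B ^ length p + ?e p \<le> 0" by simp
  qed
  then have "?e s \<le> ?e (u @ v)"
    by (simp add: radix_value_append excess_zero)
  then show ?thesis
    using length_shuffles[OF s] by (simp add: radix_value_shift)
qed

end

text \<open>
With the digits shifted by means of \<open>slope w\<close>, prefixes of \<open>w\<close> have nonpositive value and \<open>v\<close> has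
positive value. So \<open>v\<close> is neither a prefix of \<open>w\<close> nor below the prefix of \<open>w\<close> of the same length.
\<close>

lemma (in digits) lyndon_if_slope_less:
  assumes total: "\<And>a b. a = b \<or> (a, b) \<in> R \<or> (b, a) \<in> R"
    and mono: "\<And>a b. a \<in> A \<Longrightarrow> b \<in> A \<Longrightarrow> (a, b) \<in> R \<Longrightarrow> d a < d b"
    and w: "w \<noteq> []" "set w \<subseteq> A" 
    and less: "slope w < slope v"
    and v: "v \<noteq> []" "strict_suffix v w"
    and all: "\<And>x. x \<noteq> [] \<Longrightarrow> strict_suffix x w \<Longrightarrow> slope w \<le> slope x"
  shows "(w, v) \<in> lexord R"
proof (rule ccontr)
  let ?e = "excess (slope w)"
  have B: "0 < real B" using B2 by simp
  have prefix_le: "?e p \<le> 0" if "prefix p w" for p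
  proof (cases "p = []")
    case False
    obtain q where pq: "w = p @ q" using \<open>prefix p w\<close> by (auto simp: prefix_def)
    have "0 \<le> ?e q"
    proof (cases "q = []")
      case False
      then show ?thesis
        using all[of q] \<open>p \<noteq> []\<close> pq by (auto simp: excess_nonneg_iff strict_suffix_def suffix_def)
    qed simp
    moreover have "?e p * real B ^ length q + ?e q = 0"
      using excess_zero[of w] unfolding pq radix_value_append[symmetric] by simp
    ultimately have "?e p * real B ^ length q \<le> 0" by simp
    moreover have "0 < real B ^ length q" using B2 by simp
    ultimately show ?thesis by (simp add: mult_le_0_iff)
  qed simp
  have pos: "0 < ?e v" using less v(1) by (simp add: excess_pos_iff)
  assume "(w, v) \<notin> lexord R"
  moreover have "w \<noteq> v" using v by (auto simp: strict_suffix_def)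
  ultimately have "(v, w) \<in> lexord R"
    using lexord_linear[of R w v] total by auto
  then consider a x where "w = v @ a # x"
    | p a b x y where "(a, b) \<in> R" "v = p @ a # x" "w = p @ b # y"
    by (auto simp: lexord_def)
  then show False
  proof cases
    case 1
    then show False using prefix_le[of v] pos by (auto simp: prefix_def)
  next
    case 2
    have sv: "set v \<subseteq> A" using v(2) w(2) by (auto simp: strict_suffix_def suffix_def)
    have "length x \<le> length y"
      using suffix_length_le[of v w] v(2) 2 by (simp add: strict_suffix_def)
    then have len: "length x = length (take (length x) y)" by simp
    have "val v < val (p @ b # take (length x) y)"
      unfolding 2(2)
      using sv w(2) 2 len by (intro val_less mono) auto
    then have "?e v < ?e (p @ b # take (length x) y)"
      using len 2(2) by (simp add: radix_value_shift)
    also have "\<dots> \<le> 0"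
      using 2(3) by (intro prefix_le) (auto simp: prefix_def intro!: exI[of _ "drop (length x) y"])
    finally show False using pos by simp
  qed
qed

text \<open>
A proper suffix \<open>v\<close> of \<open>w\<close> with minimal slope exists, since otherwise every proper suffix would have
larger slope than \<open>w\<close>, which makes \<open>w\<close> Lyndon.
\<close>

lemma not_lyndon_split:
  fixes r :: "letter rel" and d :: "letter \<Rightarrow> nat" and B :: nat
  defines "val \<equiv> radix_value (\<lambda>a. real (d a)) (real B)"
  assumes D: "digits d A B" and r: "linear_order r"
    and mono: "\<And>a b. a \<in> A \<Longrightarrow> b \<in> A \<Longrightarrow> (a, b) \<in> r - Id \<Longrightarrow> d a < d b"
    and w: "w \<noteq> []" "set w \<subseteq> A" "\<not> lyndon r w"
  obtains u v where "u \<noteq> []" "v \<noteq> []" "w = u @ v" "\<And>s. s \<in> shuffles u v \<Longrightarrow> val s \<le> val w"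
proof -
  interpret digits d A B by (rule D)
  let ?S = "{v. suffix v w \<and> v \<noteq> []}"
  have fin: "finite ?S" by (rule finite_subset[of _ "set (suffixes w)"]) auto
  have wS: "w \<in> ?S" using w(1) by simp
  have "\<exists>v\<in>?S. v \<noteq> w \<and> (\<forall>x\<in>?S. slope v \<le> slope x)"
  proof (rule ccontr)
    assume *: "\<not> ?thesis"
    obtain m where m: "m \<in> ?S" "\<And>x. x \<in> ?S \<Longrightarrow> slope m \<le> slope x"
      using ex_is_arg_min_if_finite[OF fin, of slope] wS by (auto simp: is_arg_min_linorder)
    with * have "m = w" by blast
    with m(2) have min: "\<And>x. x \<in> ?S \<Longrightarrow> slope w \<le> slope x" by simp
    have strict: "slope w < slope x" if "x \<in> ?S" "x \<noteq> w" for x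
    proof (rule ccontr)
      assume "\<not> slope w < slope x"
      then have "slope x \<le> slope y" if "y \<in> ?S" for y using min[OF that] by linarith
      with * \<open>x \<in> ?S\<close> \<open>x \<noteq> w\<close> show False by blast
    qed
    have tot: "a = b \<or> (a, b) \<in> r - Id \<or> (b, a) \<in> r - Id" for a b
      using r by (auto simp: linear_order_on_def total_on_def)
    have "lyndon r w"
      unfolding lyndon_def
    proof (intro conjI allI impI w(1))
      fix v assume v: "v \<noteq> [] \<and> strict_suffix v w"
      have "slope w < slope v"
        using v by (intro strict) (auto simp: strict_suffix_def)
      moreover have "slope w \<le> slope x" if "x \<noteq> []" "strict_suffix x w" for x
        using that by (intro min) (auto simp: strict_suffix_def)
      ultimately show "(w, v) \<in> lexord (r - Id)"
        using lyndon_if_slope_less[of "r - Id" w v, OF tot mono w(1,2)] v by blast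
    qed
    with w(3) show False by simp
  qed
  then obtain v where v: "suffix v w" "v \<noteq> []" "v \<noteq> w" 
    and min: "\<And>x. suffix x w \<Longrightarrow> x \<noteq> [] \<Longrightarrow> slope v \<le> slope x" by auto
  from v(1) obtain u where u: "w = u @ v" by (auto simp: suffix_def)
  show thesis
    using v u min val_shuffle_le[of u v] by (intro that[of u v]) (auto simp: val_def)
qed

lemma digits_exist:
  assumes "linear_order r" "finite (A :: 'a set)"
  obtains d B where "digits d A B" "\<And>a b. a \<in> A \<Longrightarrow> b \<in> A \<Longrightarrow> (a, b) \<in> r - Id \<Longrightarrow> d a < d b"
proof -
  define d where "d a = card {x\<in>A. (x, a) \<in> r - Id}" for a
  have tr: "trans (r - Id)" and tot: "total r" and irr: "irrefl (r - Id)"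
    using assms(1) by (auto simp: linear_order_on_def partial_order_on_def preorder_on_def
      irrefl_def intro: trans_diff_Id)
  have less: "d a < d b" if "a \<in> A" "b \<in> A" "(a, b) \<in> r - Id" for a b
    unfolding d_def
  proof (rule psubset_card_mono)
    have "{x \<in> A. (x, a) \<in> r - Id} \<subseteq> {x \<in> A. (x, b) \<in> r - Id}"
      using transD[OF tr _ that(3)] by blast
    then show "{x \<in> A. (x, a) \<in> r - Id} \<subset> {x \<in> A. (x, b) \<in> r - Id}"
      using that by blast
  qed (simp add: assms(2))
  \<comment> \<open>ranks are below \<open>card A + 1\<close>; adding \<open>2\<close> ensures a base of at least \<open>2\<close> even for empty \<open>A\<close>\<close>
  have "digits d A (card A + 2)"
  proof
    fix a assume "a \<in> A"
    have "d a \<le> card A" unfolding d_def by (intro card_mono assms(2)) auto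
    then show "d a < card A + 2" by simp
  next
    show "inj_on d A"
    proof (rule inj_onI, rule ccontr)
      fix a b assume *: "a \<in> A" "b \<in> A" "d a = d b" "a \<noteq> b"
      with tot have "(a, b) \<in> r - Id \<or> (b, a) \<in> r - Id" by (auto simp: total_on_def)
      with less[of a b] less[of b a] * show False by auto
    qed
  qed simp
  with less that show thesis by blast
qed

section \<open>Straightening modulo block shuffle products\<close>

lemma lookup_word: "Poly_Mapping.lookup (word w) s = (if s = w then 1 else 0)"
  by (simp add: word_def lookup_single when_def)

lemma lookup_nc_extend:
  "Poly_Mapping.lookup (nc_extend f p) s =
    (\<Sum>w\<in>Poly_Mapping.keys p. Poly_Mapping.lookup p w * Poly_Mapping.lookup (f w) s)"
  by (simp add: nc_extend_def lookup_sum lookup_nc_scale)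

lemma nc_extend_word [simp]: "nc_extend f (word w) = f w"
  by (rule poly_mapping_eqI) (simp add: lookup_nc_extend word_def)

lemma block_shuffle_word: "block_shuffle (word u) (word v) = block_shuffle_words u v"
  by (simp add: block_shuffle_def)

lemma lookup_prepend_Cons:
  "Poly_Mapping.lookup (prepend a p) (b # s) = (if b = a then Poly_Mapping.lookup p s else 0)"
proof -
  have "Poly_Mapping.lookup (prepend a p) (b # s) =
    (\<Sum>w\<in>Poly_Mapping.keys p. if w = s then (if b = a then Poly_Mapping.lookup p s else 0) else 0)"
    unfolding prepend_def lookup_nc_extend by (rule sum.cong) (auto simp: lookup_word)
  then show ?thesis by (auto simp: sum.delta in_keys_iff)
qed

lemma keys_nc_extend_length:
  assumes "\<And>w s. w \<in> Poly_Mapping.keys p \<Longrightarrow> s \<in> Poly_Mapping.keys (f w) \<Longrightarrow> length s \<le> n"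
    and "s \<in> Poly_Mapping.keys (nc_extend f p)"
  shows "length s \<le> n"
proof -
  have "Poly_Mapping.lookup (nc_extend f p) s \<noteq> 0"
    using assms(2) by (simp add: in_keys_iff)
  then obtain w where "w \<in> Poly_Mapping.keys p" "Poly_Mapping.lookup (f w) s \<noteq> 0"
    unfolding lookup_nc_extend by (metis (mono_tags, lifting) mult_zero_right sum.neutral)
  then show ?thesis using assms(1) by (simp add: in_keys_iff)
qed

lemma keys_word: "Poly_Mapping.keys (word w) = {w}"
  by (simp add: word_def)

lemma keys_prepend_length:
  assumes "\<And>s. s \<in> Poly_Mapping.keys p \<Longrightarrow> length s \<le> n"
  shows "s \<in> Poly_Mapping.keys (prepend a p) \<Longrightarrow> length s \<le> Suc n"
  unfolding prepend_def
  by (erule keys_nc_extend_length[rotated]) (use assms in \<open>auto simp: keys_word\<close>)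

lemma keys_zeta_op_length:
  assumes "\<And>s. s \<in> Poly_Mapping.keys p \<Longrightarrow> length s \<le> n"
  shows "s \<in> Poly_Mapping.keys (zeta_op c p) \<Longrightarrow> length s \<le> n"
  unfolding zeta_op_def
  by (erule keys_nc_extend_length[rotated])
    (auto simp: keys_word dest!: assms split: list.splits)

lemma length_keys_block_shuffle_words:
  "s \<in> Poly_Mapping.keys (block_shuffle_words u v) \<Longrightarrow> length s \<le> length u + length v"
proof (induction u v arbitrary: s rule: block_shuffle_words.induct)
  case (3 a u b v)
  from 3(4) have "s \<in> Poly_Mapping.keys (prepend a (block_shuffle_words u (b # v)))
      \<or> s \<in> Poly_Mapping.keys (prepend b (block_shuffle_words (a # u) v))
      \<or> s \<in> Poly_Mapping.keys (zeta_op (idx a + idx b) (block_shuffle_words u v))"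
    by (auto simp: in_keys_iff lookup_add lookup_minus)
  then show ?case
    using keys_prepend_length[where p = "block_shuffle_words u (b # v)" and s = s, OF 3(1)]
      keys_prepend_length[where p = "block_shuffle_words (a # u) v" and s = s, OF 3(2)]
      keys_zeta_op_length[where p = "block_shuffle_words u v" and s = s, OF 3(3)]
    by fastforce
qed (auto simp: keys_word)

text \<open>
The term \<open>zeta_op\<close> merges two letters and hence does not reach this length, so in top degree the recursion
is that of the ordinary shuffle product. Its coefficients count interleavings, which is why
nothing cancels.
\<close>

lemma lookup_block_shuffle_words_top:
  assumes "length s = length u + length v"
  shows "0 \<le> Poly_Mapping.lookup (block_shuffle_words u v) s \<and>
    (Poly_Mapping.lookup (block_shuffle_words u v) s \<noteq> 0 \<longleftrightarrow> s \<in> shuffles u v)"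
  using assms
proof (induction u v arbitrary: s rule: block_shuffle_words.induct)
  case (3 a u b v)
  then obtain e t where s: "s = e # t" by (cases s) auto
  have "s \<notin> Poly_Mapping.keys (zeta_op (idx a + idx b) (block_shuffle_words u v))"
    using keys_zeta_op_length[OF length_keys_block_shuffle_words, where s = s] 3(4) by force
  then have "Poly_Mapping.lookup (block_shuffle_words (a # u) (b # v)) s =
      (if e = a then Poly_Mapping.lookup (block_shuffle_words u (b # v)) t else 0) +
      (if e = b then Poly_Mapping.lookup (block_shuffle_words (a # u) v) t else 0)"
    by (simp add: lookup_add lookup_minus s lookup_prepend_Cons in_keys_iff)
  then show ?case
    using 3(1)[of t] 3(2)[of t] 3(4) s by (auto simp: add_nonneg_eq_0_iff)
qed (auto simp: lookup_word)

lemma ncpoly_sum_words: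
  "p = (\<Sum>s\<in>Poly_Mapping.keys p. nc_scale (Poly_Mapping.lookup p s) (word s))"
  by (rule poly_mapping_eqI)
    (simp add: lookup_sum lookup_nc_scale lookup_word in_keys_iff
      sum.delta[where b = "\<lambda>s. Poly_Mapping.lookup p s", simplified] if_distrib cong: if_cong)

interpretation nc: vector_space nc_scale by (rule vector_space_nc_scale)
interpretation rat: vector_space rat_scale by (rule vector_space_rat_scale)

lemma linear_sum_words:
  assumes "Vector_Spaces.linear nc_scale rat_scale I"
  shows "I p = (\<Sum>s\<in>Poly_Mapping.keys p. rat_scale (Poly_Mapping.lookup p s) (I (word s)))"
proof -
  interpret I: Vector_Spaces.linear nc_scale rat_scale I by (rule assms)
  show ?thesis by (subst ncpoly_sum_words) (simp add: I.sum I.scale)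
qed

lemma append_in_shuffles: "u @ v \<in> shuffles u v"
proof (induction u)
  case (Cons a u)
  then show ?case by (cases v) auto
qed simp

text \<open>
Induction on the length of the word and, among words of equal length over the same finite set of
letters, on the lexicographic order. For a non-Lyndon word \<open>x = u @ v\<close>, the relation
\<open>I (block_shuffle (word u) (word v)) = 0\<close> is solved for \<open>I (word x)\<close>; \<open>x\<close> is the largest word of
maximal length in the product.
\<close>

lemma word_value_in_lyndon_image:
  fixes I :: "ncpoly \<Rightarrow> real"
  assumes r: "linear_order r"
    and lin: "Vector_Spaces.linear nc_scale rat_scale I" and "I (word []) = 0"
    and prod: "\<And>u v. u \<noteq> [] \<Longrightarrow> v \<noteq> [] \<Longrightarrow> I (block_shuffle (word u) (word v)) = 0"
  shows "I (word w) \<in> I ` lyndon_span r"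
proof -
  interpret I: Vector_Spaces.linear nc_scale rat_scale I by (rule lin)
  define S where "S = I ` lyndon_span r"
  have S: "rat.subspace S"
    unfolding S_def lyndon_span_def by (intro I.subspace_image nc.subspace_span)
  have "I (word w) \<in> S"
  proof (induction "length w" arbitrary: w rule: less_induct)
    case outer: less
    obtain d B where D: "digits d (set w) B" and
      mono: "\<And>a b. a \<in> set w \<Longrightarrow> b \<in> set w \<Longrightarrow> (a, b) \<in> r - Id \<Longrightarrow> d a < d b"
      using digits_exist[OF r finite_set[of w]] by blast
    interpret digits d "set w" B by (rule D)
    have "I (word x) \<in> S" if "set x \<subseteq> set w" "length x = length w" for x
      using that
    proof (induction "card {y. set y \<subseteq> set w \<and> length y = length w \<and> val y < val x}" arbitrary: x
        rule: less_induct)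
      case less
      have fin: "finite {y. set y \<subseteq> set w \<and> length y = length w \<and> val y < t}" for t
        by (rule finite_subset[OF _ finite_lists_length_eq[OF finite_set[of w], of "length w"]]) auto
      have smaller: "I (word y) \<in> S"
        if "set y \<subseteq> set w" "length y = length w" "val y < val x" for y
        using that by (intro less(1) psubset_card_mono fin) (auto intro: less_trans)
      consider "x = []" | "lyndon r x" | "x \<noteq> []" "\<not> lyndon r x" by blast
      then show ?case
      proof cases
        case 1
        then show ?thesis using assms(3) rat.subspace_0[OF S] by simp
      next
        case 2
        then show ?thesis
          unfolding S_def lyndon_span_def by (intro imageI nc.span_base) auto
      next
        case 3
        obtain u v where uv: "u \<noteq> []" "v \<noteq> []" "x = u @ v"
          and max: "\<And>s. s \<in> shuffles u v \<Longrightarrow> val s \<le> val x"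
          using not_lyndon_split[OF D r mono 3(1) less(2) 3(2)] by blast
        let ?p = "block_shuffle_words u v"
        let ?c = "Poly_Mapping.lookup ?p"
        have "x \<in> shuffles u v"
          unfolding uv(3) by (rule append_in_shuffles)
        then have cx: "?c x \<noteq> 0"
          using lookup_block_shuffle_words_top[of x u v] uv(3) by simp
        have rest: "rat_scale (?c s) (I (word s)) \<in> S" if s: "s \<in> Poly_Mapping.keys ?p - {x}" for s
        proof (rule rat.subspace_scale[OF S])
          have le: "length s \<le> length x"
            using length_keys_block_shuffle_words[of s u v] s uv(3) by simp
          show "I (word s) \<in> S"
          proof (cases "length s = length x")
            case False
            then show ?thesis using le less(3) by (intro outer) simp
          next
            case True
            then have sh: "s \<in> shuffles u v"
              using lookup_block_shuffle_words_top[of s u v] s uv(3) by (simp add: in_keys_iff)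
            then have "set s \<subseteq> set w"
              using set_shuffles[of s u v] less(2) uv(3) by auto
            moreover from this have "val s \<noteq> val x"
              using val_inj[of s x] less(2) True s by auto
            ultimately show ?thesis
              using max[OF sh] True less(3) by (intro smaller) auto
          qed
        qed
        have "0 = I ?p" using prod[OF uv(1,2)] by (simp add: block_shuffle_word)
        also have "\<dots> = rat_scale (?c x) (I (word x))
            + (\<Sum>s\<in>Poly_Mapping.keys ?p - {x}. rat_scale (?c s) (I (word s)))"
          using cx by (subst linear_sum_words[OF lin], subst sum.remove[of _ x])
            (auto simp: in_keys_iff)
        finally have "rat_scale (?c x) (I (word x))
            = - (\<Sum>s\<in>Poly_Mapping.keys ?p - {x}. rat_scale (?c s) (I (word s)))" by simp
        also have "\<dots> \<in> S"
          using rest by (intro rat.subspace_neg[OF S] rat.subspace_sum[OF S])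
        finally have "rat_scale (inverse (?c x)) (rat_scale (?c x) (I (word x))) \<in> S"
          by (rule rat.subspace_scale[OF S])
        then show ?thesis
          using cx by (simp add: of_rat_inverse mult.assoc[symmetric])
      qed
    qed
    then show ?case by simp
  qed
  then show ?thesis by (simp add: S_def)
qed

section \<open>The space of multiple zeta values\<close>

lemma iterated_integral_in_mzv_space:
  assumes "convergent_word as"
  shows "iterated_integral as \<in> mzv_space"
proof (cases "as = []")
  case True
  then show ?thesis
    unfolding mzv_space_def by (intro rat.span_base) (simp add: iterated_integral_Nil)
next
  case False
  with assms obtain ns where ns: "mzv_admissible ns" "as = mzv_word ns"
    by (auto simp: convergent_word_iff)
  have "rat_scale ((-1) ^ length ns) (mzv ns) \<in> mzv_space"
    unfolding mzv_space_def using ns(1) by (intro rat.span_scale rat.span_base) auto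
  then show ?thesis
    using ns by (simp add: iterated_integral_mzv_word of_rat_power of_rat_minus)
qed

text \<open>
By surjectivity of the block encoding, the conditions on a normalised integral map determine the
range of \<open>I\<close> on all words: those ending in \<open>e\<^sub>0\<close> give \<open>0\<close>, the convergent ones multiple zeta values,
and the divergent ones lie in the space by the choice of normalisation.
\<close>

lemma normalised_integral_of_word_in_mzv_space:
  assumes "normalised_integral_map I"
  shows "I (word ls) \<in> mzv_space"
proof (cases "ls = []")
  case True
  then show ?thesis
    using assms by (simp add: normalised_integral_map_def mzv_space_def rat.span_zero)
next
  case False
  then obtain w where w: "w \<noteq> []" "\<not> hd w" "block_encode w = ls"
    by (rule block_encode_surj)
  show ?thesis
  proof (cases "last w")
    case False
    then show ?thesis
      using assms w by (auto simp: normalised_integral_map_def mzv_space_def rat.span_zero)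
  next
    case True
    obtain v where v: "w = v @ [True]"
      using w(1) True by (cases w rule: rev_cases) auto
    then obtain as where "v = False # as"
      using w(2) by (cases v) auto
    with v have "ls = block_encode ([False] @ as @ [True])"
      using w(3) by simp
    then show ?thesis
      using assms iterated_integral_in_mzv_space[of as]
      by (cases "convergent_word as") (simp_all add: normalised_integral_map_def)
  qed
qed

theorem corollary4p6:
  fixes r :: "letter rel" and I :: "ncpoly \<Rightarrow> real"
  assumes "linear_order r"
    and "normalised_integral_map I"
    and "\<And>u v. u \<noteq> [] \<Longrightarrow> v \<noteq> [] \<Longrightarrow> I (block_shuffle (word u) (word v)) = 0"
  shows "mzv_space = I ` lyndon_span r"
proof
  have lin: "Vector_Spaces.linear nc_scale rat_scale I" and I_Nil: "I (word []) = 0"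
    using assms(2) by (simp_all add: normalised_integral_map_def)
  interpret I: Vector_Spaces.linear nc_scale rat_scale I by (rule lin)
  have S: "rat.subspace (I ` lyndon_span r)"
    unfolding lyndon_span_def by (intro I.subspace_image nc.subspace_span)
  have word: "I (word w) \<in> I ` lyndon_span r" for w
    using assms(1) lin I_Nil assms(3) by (rule word_value_in_lyndon_image)
  have integral: "iterated_integral as \<in> I ` lyndon_span r" if "convergent_word as" for as
    using word[of "block_encode ([False] @ as @ [True])"] assms(2) that
    by (simp add: normalised_integral_map_def)
  show "mzv_space \<subseteq> I ` lyndon_span r"
    unfolding mzv_space_def
  proof (rule rat.span_minimal[OF _ S], intro subsetI, elim insertE imageE)
    fix x assume "x = (1 :: real)"
    then show "x \<in> I ` lyndon_span r"
      using integral[of "[]"] by (simp add: convergent_word_def iterated_integral_Nil)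
  next
    fix x ns assume x: "x = mzv ns" and "ns \<in> {ns. mzv_admissible ns}"
    then have ns: "mzv_admissible ns" by simp
    then have "iterated_integral (mzv_word ns) \<in> I ` lyndon_span r"
      by (intro integral) (auto simp: convergent_word_iff)
    then have "rat_scale ((-1) ^ length ns) (iterated_integral (mzv_word ns)) \<in> I ` lyndon_span r"
      by (rule rat.subspace_scale[OF S])
    then show "x \<in> I ` lyndon_span r"
      using ns x by (simp add: iterated_integral_mzv_word of_rat_power of_rat_minus
          mult.assoc[symmetric] power_mult_distrib[symmetric])
  qed
  show "I ` lyndon_span r \<subseteq> mzv_space"
    unfolding lyndon_span_def I.span_image[symmetric]
    unfolding mzv_space_def
  proof (rule rat.span_minimal)
    show "I ` word ` {w. lyndon r w}
        \<subseteq> rat.span (insert 1 (mzv ` {ns. mzv_admissible ns}))"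
      using normalised_integral_of_word_in_mzv_space[OF assms(2)] by (auto simp: mzv_space_def)
  qed (rule rat.subspace_span)
qed

end
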